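(* Let $G$ be a finitely generated group. Suppose that $G$ is equationally noetherian, or that $G$ is finitely presented and Hopfian. Then every $\exists^{+}$-elementary endomorphism $\varphi:G\to G$ is an automorphism.
   Context: A group $G$ is equationally noetherian if every infinite system $\Sigma$ of equations in finitely many variables $x_1,\ldots,x_n$ is equivalent to a finite subsystem of $\Sigma$, i.e. has the same set of solutions in $G^n$ as some finite subsystem; here an equation is $w(x_1,\ldots,x_n)=1$ with $w$ a word in the variables and their inverses. A group is Hopfian if every surjective endomorphism of it is an automorphism. An existential positive formula ($\exists^{+}$-formula) is a first-order formula in the language of groups built from equations using only $\wedge$, $\vee$ and $\exists$ (no universal quantifier and no inequation). An endomorphism $\varphi$ of $G$ is $\exists^{+}$-elementary (an $\exists^{+}$-endomorphism) if for every $\exists^{+}$-formula $\theta(x_1,\ldots,x_k)$ and every $(g_1,\ldots,g_k)\in G^k$, the statement $\theta(g_1,\ldots,g_k)$ is true in $G$ if and only if $\theta(\varphi(g_1),\ldots,\varphi(g_k))$ is true in $G$. (Such a morphism is not assumed injective.) *)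

theory Defs
  imports "HOL-Algebra.Algebra"
begin

text \<open>The letter \<open>(i, True)\<close> stands for $x_i$, the letter \<open>(i, False)\<close> for $x_i^{-1}$.\<close>

type_synonym gword = "(nat \<times> bool) list"

definition gwords :: "nat \<Rightarrow> gword set" where
  "gwords n = lists ({..<n} \<times> UNIV)"

definition gword_vars :: "gword \<Rightarrow> nat set" where
  "gword_vars w = fst ` set w"

primrec gword_val :: "('a, 'b) monoid_scheme \<Rightarrow> (nat \<Rightarrow> 'a) \<Rightarrow> gword \<Rightarrow> 'a" where
  "gword_val G a [] = \<one>\<^bsub>G\<^esub>"
| "gword_val G a (l # w) =
     (if snd l then a (fst l) else inv\<^bsub>G\<^esub> (a (fst l))) \<otimes>\<^bsub>G\<^esub> gword_val G a w"


section \<open>Equationally noetherian and Hopfian groups\<close>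

text \<open>A system of equations is a set of words, each \<open>w\<close> standing for the equation \<open>w = 1\<close>.\<close>

definition solutions :: "('a, 'b) monoid_scheme \<Rightarrow> nat \<Rightarrow> gword set \<Rightarrow> (nat \<Rightarrow> 'a) set" where
  "solutions G n \<Sigma> =
     {a \<in> {..<n} \<rightarrow>\<^sub>E carrier G. \<forall>w\<in>\<Sigma>. gword_val G a w = \<one>\<^bsub>G\<^esub>}"

definition equationally_noetherian :: "('a, 'b) monoid_scheme \<Rightarrow> bool" where
  "equationally_noetherian G \<longleftrightarrow>
     (\<forall>n \<Sigma>. \<Sigma> \<subseteq> gwords n \<and> infinite \<Sigma> \<longrightarrow>
        (\<exists>\<Sigma>\<^sub>0. finite \<Sigma>\<^sub>0 \<and> \<Sigma>\<^sub>0 \<subseteq> \<Sigma> \<and> solutions G n \<Sigma>\<^sub>0 = solutions G n \<Sigma>))"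

definition hopfian :: "('a, 'b) monoid_scheme \<Rightarrow> bool" where
  "hopfian G \<longleftrightarrow> (\<forall>\<phi> \<in> epi G G. \<phi> \<in> iso G G)"


section \<open>Finitely generated and finitely presented groups\<close>

definition finitely_generated :: "('a, 'b) monoid_scheme \<Rightarrow> bool" where
  "finitely_generated G \<longleftrightarrow> (\<exists>S. finite S \<and> S \<subseteq> carrier G \<and> generate G S = carrier G)"

inductive_set free_rel :: "nat \<Rightarrow> (gword \<times> gword) set" for n where
  refl: "w \<in> gwords n \<Longrightarrow> (w, w) \<in> free_rel n"
| sym: "(v, w) \<in> free_rel n \<Longrightarrow> (w, v) \<in> free_rel n"
| trans: "(u, v) \<in> free_rel n \<Longrightarrow> (v, w) \<in> free_rel n \<Longrightarrow> (u, w) \<in> free_rel n"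
| cancel: "u \<in> gwords n \<Longrightarrow> v \<in> gwords n \<Longrightarrow> i < n \<Longrightarrow>
    (u @ (i, b) # (i, \<not> b) # v, u @ v) \<in> free_rel n"

definition free_group :: "nat \<Rightarrow> gword set monoid" where
  "free_group n =
     \<lparr>carrier = gwords n // free_rel n,
      monoid.mult = (\<lambda>A B. \<Union>u\<in>A. \<Union>v\<in>B. free_rel n `` {u @ v}),
      one = free_rel n `` {[]}\<rparr>"

definition normal_closure :: "('a, 'b) monoid_scheme \<Rightarrow> 'a set \<Rightarrow> 'a set" where
  "normal_closure G R = \<Inter>{N. N \<lhd> G \<and> R \<subseteq> N}"

definition finitely_presented :: "('a, 'b) monoid_scheme \<Rightarrow> bool" where
  "finitely_presented G \<longleftrightarrow>
     (\<exists>n R. finite R \<and> R \<subseteq> carrier (free_group n) \<and>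
        G \<cong> free_group n Mod normal_closure (free_group n) R)"


section \<open>Existential positive formulas\<close>

datatype ep_formula =
    Eqn gword
  | Conj ep_formula ep_formula
  | Disj ep_formula ep_formula
  | Exists nat ep_formula

primrec free_vars :: "ep_formula \<Rightarrow> nat set" where
  "free_vars (Eqn w) = gword_vars w"
| "free_vars (Conj \<theta> \<psi>) = free_vars \<theta> \<union> free_vars \<psi>"
| "free_vars (Disj \<theta> \<psi>) = free_vars \<theta> \<union> free_vars \<psi>"
| "free_vars (Exists i \<theta>) = free_vars \<theta> - {i}"

primrec satisfies :: "('a, 'b) monoid_scheme \<Rightarrow> (nat \<Rightarrow> 'a) \<Rightarrow> ep_formula \<Rightarrow> bool" where
  "satisfies G a (Eqn w) \<longleftrightarrow> gword_val G a w = \<one>\<^bsub>G\<^esub>"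
| "satisfies G a (Conj \<theta> \<psi>) \<longleftrightarrow> satisfies G a \<theta> \<and> satisfies G a \<psi>"
| "satisfies G a (Disj \<theta> \<psi>) \<longleftrightarrow> satisfies G a \<theta> \<or> satisfies G a \<psi>"
| "satisfies G a (Exists i \<theta>) \<longleftrightarrow> (\<exists>g\<in>carrier G. satisfies G (a(i := g)) \<theta>)"

text \<open>Only the values of \<open>g\<close> on \<open>{..<k}\<close> matter below, as \<open>satisfies G a \<theta>\<close> depends on \<open>a\<close> only
  through its restriction to \<open>free_vars \<theta>\<close>.\<close>

definition ep_elementary_endo :: "('a, 'b) monoid_scheme \<Rightarrow> ('a \<Rightarrow> 'a) \<Rightarrow> bool" where
  "ep_elementary_endo G \<phi> \<longleftrightarrow>
     \<phi> \<in> hom G G \<and>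
     (\<forall>k \<theta> g. free_vars \<theta> \<subseteq> {..<k} \<and> g \<in> {..<k} \<rightarrow> carrier G \<longrightarrow>
        (satisfies G g \<theta> \<longleftrightarrow> satisfies G (\<lambda>i. \<phi> (g i)) \<theta>))"


section \<open>Well-formedness of the definitions\<close>

lemma satisfies_cong:
  assumes "\<And>i. i \<in> free_vars \<theta> \<Longrightarrow> a i = b i"
  shows "satisfies G a \<theta> \<longleftrightarrow> satisfies G b \<theta>"
  using assms
proof (induction \<theta> arbitrary: a b)
  case (Eqn w)
  then have "gword_val G a w = gword_val G b w"
    by (induction w) (auto simp: gword_vars_def)
  then show ?case by simp
next
  case (Conj \<theta> \<psi>)
  then show ?case by (metis UnCI free_vars.simps(2) satisfies.simps(2))
next
  case (Disj \<theta> \<psi>)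
  then show ?case by (metis UnCI free_vars.simps(3) satisfies.simps(3))
next
  case (Exists i \<theta>)
  have "satisfies G (a(i := g)) \<theta> \<longleftrightarrow> satisfies G (b(i := g)) \<theta>" for g
    using Exists.prems by (intro Exists.IH) auto
  then show ?case by simp
qed

lemma gwords_append: "u @ v \<in> gwords n \<longleftrightarrow> u \<in> gwords n \<and> v \<in> gwords n"
  by (auto simp: gwords_def)

lemma free_rel_gwords: "(u, v) \<in> free_rel n \<Longrightarrow> u \<in> gwords n \<and> v \<in> gwords n"
  by (induction rule: free_rel.induct) (auto simp: gwords_def)

lemma equiv_free_rel: "equiv (gwords n) (free_rel n)"
proof (rule equivI)
  show "free_rel n \<subseteq> gwords n \<times> gwords n" using free_rel_gwords by auto
  show "refl_on (gwords n) (free_rel n)"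
    by (auto simp: refl_on_def free_rel.refl)
  show "sym (free_rel n)" by (auto intro: symI free_rel.sym)
  show "trans (free_rel n)" by (auto intro: transI free_rel.trans)
qed

lemma free_rel_append_right:
  "(u, v) \<in> free_rel n \<Longrightarrow> w \<in> gwords n \<Longrightarrow> (u @ w, v @ w) \<in> free_rel n"
proof (induction rule: free_rel.induct)
  case (cancel u v i b)
  then show ?case using free_rel.cancel[of u n "v @ w" i b] by (simp add: gwords_append)
qed (auto intro: free_rel.intros simp: gwords_append)

lemma free_rel_append_left:
  "(u, v) \<in> free_rel n \<Longrightarrow> w \<in> gwords n \<Longrightarrow> (w @ u, w @ v) \<in> free_rel n"
proof (induction rule: free_rel.induct)
  case (cancel u v i b)
  then show ?case using free_rel.cancel[of "w @ u" n v i b] by (simp add: gwords_append)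
qed (auto intro: free_rel.intros simp: gwords_append)

lemma free_rel_append:
  "(u, u') \<in> free_rel n \<Longrightarrow> (v, v') \<in> free_rel n \<Longrightarrow> (u @ v, u' @ v') \<in> free_rel n"
  by (meson free_rel.trans free_rel_append_left free_rel_append_right free_rel_gwords)

lemma free_group_mult:
  assumes "u \<in> gwords n" "v \<in> gwords n"
  shows "free_rel n `` {u} \<otimes>\<^bsub>free_group n\<^esub> free_rel n `` {v} = free_rel n `` {u @ v}"
proof -
  have eq: "free_rel n `` {u' @ v'} = free_rel n `` {u @ v}"
    if "u' \<in> free_rel n `` {u}" "v' \<in> free_rel n `` {v}" for u' v'
    using that equiv_class_eq[OF equiv_free_rel free_rel_append, of u u' n v v'] by simp
  have "u \<in> free_rel n `` {u}" "v \<in> free_rel n `` {v}"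
    using assms by (auto intro: free_rel.refl)
  moreover have "free_rel n `` {u} \<otimes>\<^bsub>free_group n\<^esub> free_rel n `` {v} =
      (\<Union>u'\<in>free_rel n `` {u}. \<Union>v'\<in>free_rel n `` {v}. free_rel n `` {u @ v})"
    unfolding free_group_def monoid.simps by (intro SUP_cong HOL.refl eq)
  ultimately show ?thesis by blast
qed

definition gword_inv :: "gword \<Rightarrow> gword" where
  "gword_inv w = rev (map (\<lambda>(i, b). (i, \<not> b)) w)"

lemma gword_inv_gwords: "w \<in> gwords n \<Longrightarrow> gword_inv w \<in> gwords n"
  by (auto simp: gword_inv_def gwords_def)

lemma free_rel_gword_inv: "w \<in> gwords n \<Longrightarrow> (gword_inv w @ w, []) \<in> free_rel n"
proof (induction w)
  case Nil
  then show ?case by (auto simp: gword_inv_def intro: free_rel.refl)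
next
  case (Cons l w)
  obtain i b where l: "l = (i, b)" by (cases l)
  have w: "w \<in> gwords n" "i < n" using Cons.prems l by (auto simp: gwords_def)
  have "(gword_inv w @ (i, \<not> b) # (i, \<not> \<not> b) # w, gword_inv w @ w) \<in> free_rel n"
    using w by (intro free_rel.cancel gword_inv_gwords)
  then show ?case
    using free_rel.trans Cons.IH[OF w(1)] by (simp add: l gword_inv_def)
qed

lemma carrier_free_groupE:
  assumes "A \<in> carrier (free_group n)"
  obtains w where "w \<in> gwords n" "A = free_rel n `` {w}"
  using assms by (auto simp: free_group_def elim: quotientE)

lemma carrier_free_groupI: "w \<in> gwords n \<Longrightarrow> free_rel n `` {w} \<in> carrier (free_group n)"
  by (auto simp: free_group_def intro: quotientI)

lemma one_free_group: "\<one>\<^bsub>free_group n\<^esub> = free_rel n `` {[]}"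
  by (simp add: free_group_def)

lemma group_free_group: "group (free_group n)"
proof (rule groupI)
  have nil: "[] \<in> gwords n" by (simp add: gwords_def)
  show "\<one>\<^bsub>free_group n\<^esub> \<in> carrier (free_group n)"
    using nil by (simp add: one_free_group carrier_free_groupI)
  fix A B C
  assume "A \<in> carrier (free_group n)"
  then obtain u where u: "u \<in> gwords n" "A = free_rel n `` {u}" by (rule carrier_free_groupE)
  show "\<one>\<^bsub>free_group n\<^esub> \<otimes>\<^bsub>free_group n\<^esub> A = A"
    using u nil by (simp add: one_free_group free_group_mult)
  show "\<exists>B\<in>carrier (free_group n). B \<otimes>\<^bsub>free_group n\<^esub> A = \<one>\<^bsub>free_group n\<^esub>"
  proof (rule bexI)
    show "free_rel n `` {gword_inv u} \<in> carrier (free_group n)"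
      using u by (simp add: carrier_free_groupI gword_inv_gwords)
    show "free_rel n `` {gword_inv u} \<otimes>\<^bsub>free_group n\<^esub> A = \<one>\<^bsub>free_group n\<^esub>"
      using u equiv_class_eq[OF equiv_free_rel free_rel_gword_inv[OF u(1)]]
      by (simp add: one_free_group free_group_mult gword_inv_gwords)
  qed
  assume "B \<in> carrier (free_group n)"
  then obtain v where v: "v \<in> gwords n" "B = free_rel n `` {v}" by (rule carrier_free_groupE)
  show "A \<otimes>\<^bsub>free_group n\<^esub> B \<in> carrier (free_group n)"
    using u v by (simp add: free_group_mult carrier_free_groupI gwords_append)
  assume "C \<in> carrier (free_group n)"
  then obtain w where w: "w \<in> gwords n" "C = free_rel n `` {w}" by (rule carrier_free_groupE)
  show "A \<otimes>\<^bsub>free_group n\<^esub> B \<otimes>\<^bsub>free_group n\<^esub> C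
      = A \<otimes>\<^bsub>free_group n\<^esub> (B \<otimes>\<^bsub>free_group n\<^esub> C)"
    using u v w by (simp add: free_group_mult gwords_append)
qed

lemma (in group) normal_closure_normal:
  assumes "R \<subseteq> carrier G"
  shows "normal_closure G R \<lhd> G"
proof -
  let ?N = "{N. N \<lhd> G \<and> R \<subseteq> N}"
  have "carrier G \<lhd> G" by (simp add: normal_inv_iff subgroup_self)
  then have ne: "?N \<noteq> {}" using assms by blast
  have "subgroup (\<Inter>?N) G"
    using ne by (intro subgroups_Inter) (auto simp: normal_inv_iff)
  then show ?thesis
    unfolding normal_closure_def by (subst normal_inv_iff) (auto dest: normal.inv_op_closed2)
qed

end

theory Submission
  imports Defs
begin

text \<open>
  Let \<open>s\<close> be a suitable finite generating tuple of \<open>G\<close> and write \<open>\<phi> (s i) = w i (s)\<close> for words \<open>w i\<close>.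
  Under either hypothesis there is a finite set \<open>\<Sigma>\<close> of relators of \<open>s\<close> such that every tuple
  \<open>y\<close> of \<open>G\<close> that satisfies \<open>\<Sigma>\<close> satisfies all relators of \<open>s\<close>
  (lemmas \<open>finite_relators_noetherian\<close> and \<open>finite_relators_presented\<close>); such a \<open>y\<close> is
  the image of \<open>s\<close> under an endomorphism (lemma \<open>endomorphism_extending\<close>).
  Now consider the existential positive formula
  \<open>\<theta>(x) = \<exists>y. \<Sigma>(y) = 1 \<and> (\<forall>i. x i = w i (y))\<close>. It holds at \<open>x = \<phi> s\<close>, with witness
  \<open>y = s\<close>. Since \<open>\<phi>\<close> reflects the truth of \<open>\<theta>\<close>, it holds at \<open>x = s\<close>: there is an
  endomorphism \<open>\<psi>\<close> with \<open>s i = w i (\<psi> s) = \<psi> (w i (s)) = \<psi> (\<phi> (s i))\<close>. So \<open>\<phi>\<close> has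
  a left inverse \<open>\<psi>\<close> (lemma \<open>ep_elementary_left_inverse\<close>).

  In particular \<open>\<psi>\<close> is surjective, hence injective when \<open>G\<close> is Hopfian, and then \<open>\<phi>\<close> is
  its two-sided inverse. A finitely generated equationally noetherian group is Hopfian
  (lemma \<open>noetherian_hopfian\<close>): the kernels of the powers of an endomorphism form an ascending chain,
  which is constant from some point on because the relators of the tuples \<open>\<psi>\<^sup>k s\<close> together form a
  system equivalent to a finite part of it.
\<close>

section \<open>Values of words\<close>

lemma gwords_Cons: "l # w \<in> gwords n \<longleftrightarrow> fst l < n \<and> w \<in> gwords n"
  by (cases l) (auto simp: gwords_def)

lemma gword_val_cong:
  assumes "\<And>i. i < n \<Longrightarrow> a i = b i" "w \<in> gwords n"
  shows "gword_val G a w = gword_val G b w"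
  using assms(2) by (induction w) (auto simp: gwords_Cons assms(1))

context group
begin

lemma gword_val_closed:
  assumes "a \<in> {..<n} \<rightarrow> carrier G" "w \<in> gwords n"
  shows "gword_val G a w \<in> carrier G"
  using assms(2) by (induction w) (use assms(1) in \<open>auto simp: gwords_Cons Pi_iff\<close>)

lemma gword_val_append:
  assumes "a \<in> {..<n} \<rightarrow> carrier G" "u \<in> gwords n" "v \<in> gwords n"
  shows "gword_val G a (u @ v) = gword_val G a u \<otimes> gword_val G a v"
  using assms(2)
proof (induction u)
  case Nil
  then show ?case using gword_val_closed[OF assms(1,3)] by simp
next
  case (Cons l u)
  then have "a (fst l) \<in> carrier G" "u \<in> gwords n"
    using assms(1) by (auto simp: gwords_Cons Pi_iff)
  then show ?case
    using Cons.IH gword_val_closed[OF assms(1)] assms(3) by (simp add: m_assoc)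
qed

lemma gword_val_free_rel:
  assumes "a \<in> {..<n} \<rightarrow> carrier G" "(u, v) \<in> free_rel n"
  shows "gword_val G a u = gword_val G a v"
  using assms(2)
proof (induction rule: free_rel.induct)
  case (cancel u v i b)
  have ai: "a i \<in> carrier G" using assms(1) cancel by auto
  have c: "gword_val G a u \<in> carrier G" "gword_val G a v \<in> carrier G"
    using gword_val_closed[OF assms(1)] cancel by auto
  have "gword_val G a ((i, b) # (i, \<not> b) # v) = gword_val G a v"
    using ai c by (cases b) (simp_all add: m_assoc[symmetric])
  moreover have "(i, b) # (i, \<not> b) # v \<in> gwords n"
    using cancel by (simp add: gwords_Cons)
  ultimately show ?case
    using cancel gword_val_append[OF assms(1)] by metis
qed auto

lemma gword_val_gword_inv:
  assumes "a \<in> {..<n} \<rightarrow> carrier G" "w \<in> gwords n"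
  shows "gword_val G a (gword_inv w) = inv (gword_val G a w)"
proof -
  have "gword_val G a (gword_inv w) \<otimes> gword_val G a w = \<one>"
    using gword_val_free_rel[OF assms(1) free_rel_gword_inv[OF assms(2)]]
      gword_val_append[OF assms(1)] assms(2) by (simp add: gword_inv_gwords)
  then show ?thesis
    using gword_val_closed[OF assms(1)] assms(2) by (metis gword_inv_gwords inv_equality)
qed

lemma gword_val_eq_iff:
  assumes "a \<in> {..<n} \<rightarrow> carrier G" "u \<in> gwords n" "v \<in> gwords n"
  shows "gword_val G a u = gword_val G a v \<longleftrightarrow> gword_val G a (u @ gword_inv v) = \<one>"
proof -
  have "gword_val G a (u @ gword_inv v) = gword_val G a u \<otimes> inv (gword_val G a v)"
    using assms gword_val_append gword_val_gword_inv by (simp add: gword_inv_gwords)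
  then show ?thesis
    using gword_val_closed[OF assms(1)] assms(2,3) by (metis inv_closed inv_equality inv_inv r_inv)
qed

lemma hom_gword_val:
  assumes "group H" "h \<in> hom G H" "a \<in> {..<n} \<rightarrow> carrier G" "w \<in> gwords n"
  shows "h (gword_val G a w) = gword_val H (\<lambda>i. h (a i)) w"
proof -
  interpret h: group_hom G H h
    using assms(1,2) by (simp add: group_hom_def group_hom_axioms_def is_group)
  show ?thesis using assms(4)
  proof (induction w)
    case (Cons l w)
    then have "a (fst l) \<in> carrier G" "gword_val G a w \<in> carrier G"
      using assms(3) gword_val_closed[OF assms(3)] by (auto simp: gwords_Cons Pi_iff)
    then show ?case using Cons by (simp add: gwords_Cons)
  qed simp
qed

end


section \<open>Generating tuples and their relators\<close>

definition generating_tuple :: "('a, 'b) monoid_scheme \<Rightarrow> nat \<Rightarrow> (nat \<Rightarrow> 'a) \<Rightarrow> bool" where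
  "generating_tuple G n s \<longleftrightarrow>
     s \<in> {..<n} \<rightarrow> carrier G \<and> carrier G \<subseteq> gword_val G s ` gwords n"

definition relators :: "('a, 'b) monoid_scheme \<Rightarrow> nat \<Rightarrow> (nat \<Rightarrow> 'a) \<Rightarrow> gword set" where
  "relators G n s = {w \<in> gwords n. gword_val G s w = \<one>\<^bsub>G\<^esub>}"

text \<open>This is weaker than a finite presentation: the finitely many relators need to imply the others
  only for tuples of \<open>G\<close> itself.\<close>

definition finitely_related_tuple :: "('a, 'b) monoid_scheme \<Rightarrow> nat \<Rightarrow> (nat \<Rightarrow> 'a) \<Rightarrow> bool" where
  "finitely_related_tuple G n s \<longleftrightarrow>
     (\<exists>\<Sigma>. finite \<Sigma> \<and> \<Sigma> \<subseteq> relators G n s \<and>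
        (\<forall>y \<in> {..<n} \<rightarrow> carrier G. \<Sigma> \<subseteq> relators G n y \<longrightarrow> relators G n s \<subseteq> relators G n y))"

context group
begin

lemma generating_tuple_exists:
  assumes "finitely_generated G"
  obtains n s where "generating_tuple G n s"
proof -
  obtain S where S: "finite S" "S \<subseteq> carrier G" "generate G S = carrier G"
    using assms by (auto simp: finitely_generated_def)
  obtain n :: nat and s where s: "S = s ` {i. i < n}"
    using S(1) finite_imp_nat_seg_image_inj_on by metis
  have sc: "s \<in> {..<n} \<rightarrow> carrier G" using S(2) s by auto
  have "\<exists>w\<in>gwords n. gword_val G s w = g" if "g \<in> generate G S" for g
    using that
  proof (induction rule: generate.induct)
    case one
    show ?case by (rule bexI[of _ "[]"]) (auto simp: gwords_def)
  next
    case (incl h)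
    then obtain i where "i < n" "h = s i" using s by auto
    moreover from this have "s i \<in> carrier G" using sc by auto
    ultimately show ?case by (intro bexI[of _ "[(i, True)]"]) (auto simp: gwords_def)
  next
    case (inv h)
    then obtain i where "i < n" "h = s i" using s by auto
    moreover from this have "s i \<in> carrier G" using sc by auto
    ultimately show ?case by (intro bexI[of _ "[(i, False)]"]) (auto simp: gwords_def)
  next
    case (eng h1 h2)
    then obtain u v where "u \<in> gwords n" "gword_val G s u = h1" "v \<in> gwords n" "gword_val G s v = h2"
      by auto
    then show ?case
      using gword_val_append[OF sc] by (intro bexI[of _ "u @ v"]) (auto simp: gwords_append)
  qed
  then have "generating_tuple G n s"
    using sc S(3) unfolding generating_tuple_def by blast
  then show thesis by (rule that)
qed

lemma hom_eq_on_generating_tuple: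
  assumes "generating_tuple G n s" "h \<in> hom G G" "k \<in> hom G G"
    and "\<And>i. i < n \<Longrightarrow> h (s i) = k (s i)" "g \<in> carrier G"
  shows "h g = k g"
proof -
  have s: "s \<in> {..<n} \<rightarrow> carrier G" using assms(1) by (simp add: generating_tuple_def)
  obtain w where w: "w \<in> gwords n" "g = gword_val G s w"
    using assms(1,5) by (auto simp: generating_tuple_def)
  show ?thesis
    unfolding w(2) hom_gword_val[OF is_group assms(2) s w(1)] hom_gword_val[OF is_group assms(3) s w(1)]
    by (rule gword_val_cong[OF assms(4) w(1)])
qed

text \<open>Sending the value of a word at \<open>s\<close> to its value at \<open>y\<close> does not depend on the word:
  two words with the same value at \<open>s\<close> differ by a relator of \<open>s\<close>.\<close>

lemma endomorphism_extending:
  assumes gen: "generating_tuple G n s"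
    and y: "y \<in> {..<n} \<rightarrow> carrier G" and rel: "relators G n s \<subseteq> relators G n y"
  obtains \<psi> where "\<psi> \<in> hom G G" "\<And>i. i < n \<Longrightarrow> \<psi> (s i) = y i"
proof -
  have s: "s \<in> {..<n} \<rightarrow> carrier G" and surj: "carrier G \<subseteq> gword_val G s ` gwords n"
    using gen by (auto simp: generating_tuple_def)
  define word where "word g = (SOME w. w \<in> gwords n \<and> gword_val G s w = g)" for g
  have word: "word g \<in> gwords n \<and> gword_val G s (word g) = g" if "g \<in> carrier G" for g
    unfolding word_def by (rule someI_ex) (use that surj in auto)
  define \<psi> where "\<psi> g = gword_val G y (word g)" for g
  have val: "\<psi> (gword_val G s w) = gword_val G y w" if w: "w \<in> gwords n" for w
  proof -
    let ?v = "word (gword_val G s w)"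
    have v: "?v \<in> gwords n" "gword_val G s ?v = gword_val G s w"
      using word gword_val_closed[OF s w] by auto
    then have "?v @ gword_inv w \<in> relators G n s"
      using gword_val_eq_iff[OF s v(1) w] w by (simp add: relators_def gwords_append gword_inv_gwords)
    then show ?thesis
      using rel gword_val_eq_iff[OF y v(1) w] by (auto simp: relators_def \<psi>_def)
  qed
  have "\<psi> \<in> hom G G"
  proof (rule homI)
    fix g h assume "g \<in> carrier G" "h \<in> carrier G"
    then have u: "word g \<in> gwords n" "gword_val G s (word g) = g"
      and v: "word h \<in> gwords n" "gword_val G s (word h) = h"
      using word by auto
    show "\<psi> g \<in> carrier G" using gword_val_closed[OF y u(1)] by (simp add: \<psi>_def)
    have "\<psi> (g \<otimes> h) = gword_val G y (word g @ word h)"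
      using val[of "word g @ word h"] u v by (simp add: gwords_append gword_val_append[OF s])
    then show "\<psi> (g \<otimes> h) = \<psi> g \<otimes> \<psi> h"
      using gword_val_append[OF y u(1) v(1)] by (simp add: \<psi>_def)
  qed
  moreover have "\<psi> (s i) = y i" if "i < n" for i
  proof -
    have "s i \<in> carrier G" "y i \<in> carrier G" using that s y by auto
    then show ?thesis using val[of "[(i, True)]"] that by (simp add: gwords_def)
  qed
  ultimately show thesis by (rule that)
qed


section \<open>Equationally noetherian groups\<close>

lemma noetherian_finite_subsystem:
  assumes "equationally_noetherian G" "\<Sigma> \<subseteq> gwords n"
  obtains \<Sigma>\<^sub>0 where "finite \<Sigma>\<^sub>0" "\<Sigma>\<^sub>0 \<subseteq> \<Sigma>"
    "\<forall>y \<in> {..<n} \<rightarrow> carrier G. \<Sigma>\<^sub>0 \<subseteq> relators G n y \<longrightarrow> \<Sigma> \<subseteq> relators G n y"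
proof (cases "finite \<Sigma>")
  case True
  then show thesis using that by blast
next
  case False
  with assms have "\<exists>\<Sigma>\<^sub>0. finite \<Sigma>\<^sub>0 \<and> \<Sigma>\<^sub>0 \<subseteq> \<Sigma> \<and> solutions G n \<Sigma>\<^sub>0 = solutions G n \<Sigma>"
    by (simp add: equationally_noetherian_def)
  then obtain \<Sigma>\<^sub>0 where \<Sigma>\<^sub>0: "finite \<Sigma>\<^sub>0" "\<Sigma>\<^sub>0 \<subseteq> \<Sigma>" "solutions G n \<Sigma>\<^sub>0 = solutions G n \<Sigma>"
    by metis
  \<comment> \<open>Solutions are extensional functions, so tuples are compared after restriction to \<open>{..<n}\<close>.\<close>
  have sol: "restrict y {..<n} \<in> solutions G n T \<longleftrightarrow> T \<subseteq> relators G n y"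
    if "y \<in> {..<n} \<rightarrow> carrier G" "T \<subseteq> gwords n" for y T
  proof -
    have "gword_val G (restrict y {..<n}) w = gword_val G y w" if "w \<in> T" for w
      by (rule gword_val_cong[of n]) (use that \<open>T \<subseteq> gwords n\<close> in auto)
    moreover have "restrict y {..<n} \<in> {..<n} \<rightarrow>\<^sub>E carrier G"
      using that(1) by (simp add: restrict_PiE_iff Pi_iff)
    ultimately show ?thesis
      using that(2) unfolding solutions_def relators_def by auto
  qed
  show thesis
  proof (rule that[OF \<Sigma>\<^sub>0(1,2)], intro ballI impI)
    fix y assume "y \<in> {..<n} \<rightarrow> carrier G" "\<Sigma>\<^sub>0 \<subseteq> relators G n y"
    then show "\<Sigma> \<subseteq> relators G n y"
      using sol[of y \<Sigma>\<^sub>0] sol[of y \<Sigma>] \<Sigma>\<^sub>0(2,3) assms(2) by auto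
  qed
qed

lemma finite_relators_noetherian:
  assumes "equationally_noetherian G"
  shows "finitely_related_tuple G n s"
proof -
  have "relators G n s \<subseteq> gwords n" by (auto simp: relators_def)
  then show ?thesis
    by (rule noetherian_finite_subsystem[OF assms])
      (unfold finitely_related_tuple_def, intro exI conjI)
qed

text \<open>If \<open>\<psi> g = \<one>\<close> and the kernels of the powers of \<open>\<psi>\<close> are constant from \<open>m\<close> on, then
  writing \<open>g = \<psi>\<^sup>m h\<close> by surjectivity gives \<open>h \<in> ker \<psi>\<^sup>m\<^sup>+\<^sup>1 = ker \<psi>\<^sup>m\<close>, so \<open>g = \<one>\<close>.\<close>

lemma noetherian_hopfian:
  assumes "finitely_generated G" "equationally_noetherian G"
  shows "hopfian G"
  unfolding hopfian_def
proof
  fix \<psi> assume "\<psi> \<in> epi G G"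
  then have hom: "\<psi> \<in> hom G G" and surj: "\<psi> ` carrier G = carrier G"
    by (auto simp: epi_def)
  obtain n s where gen: "generating_tuple G n s" using generating_tuple_exists[OF assms(1)] .
  have s: "s \<in> {..<n} \<rightarrow> carrier G" using gen by (simp add: generating_tuple_def)
  have pow_hom: "\<psi> ^^ k \<in> hom G G" for k
    by (induction k) (use hom in \<open>auto simp: hom_def Pi_iff\<close>)
  have pow_surj: "(\<psi> ^^ k) ` carrier G = carrier G" for k
  proof (induction k)
    case (Suc k)
    have "(\<psi> ^^ Suc k) ` carrier G = \<psi> ` ((\<psi> ^^ k) ` carrier G)" by (simp add: image_image)
    then show ?case using Suc surj by simp
  qed simp
  define y where "y k i = (\<psi> ^^ k) (s i)" for k i
  have y: "y k \<in> {..<n} \<rightarrow> carrier G" for k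
    using pow_hom[of k] s by (auto simp: y_def hom_def)
  have val: "gword_val G (y k) w = (\<psi> ^^ k) (gword_val G s w)" if "w \<in> gwords n" for k w
    using hom_gword_val[OF is_group pow_hom s that] by (simp add: y_def[abs_def])
  have one: "\<psi> \<one> = \<one>" using hom hom_one is_group by blast
  have step: "relators G n (y k) \<subseteq> relators G n (y (Suc k))" for k
    using one by (auto simp: relators_def val)
  then have mono: "relators G n (y j) \<subseteq> relators G n (y k)" if "j \<le> k" for j k
    using that by (rule lift_Suc_mono_le)
  have "(\<Union>k. relators G n (y k)) \<subseteq> gwords n" by (auto simp: relators_def)
  then obtain \<Sigma> where \<Sigma>: "finite \<Sigma>" "\<Sigma> \<subseteq> (\<Union>k. relators G n (y k))"
    "\<forall>z \<in> {..<n} \<rightarrow> carrier G. \<Sigma> \<subseteq> relators G n z \<longrightarrow> (\<Union>k. relators G n (y k)) \<subseteq> relators G n z"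
    by (rule noetherian_finite_subsystem[OF assms(2)])
  obtain m where m: "\<Sigma> \<subseteq> relators G n (y m)"
  proof -
    obtain K where K: "finite K" "\<Sigma> \<subseteq> (\<Union>k\<in>K. relators G n (y k))"
      using finite_subset_Union[of \<Sigma> "range (\<lambda>k. relators G n (y k))"] \<Sigma>(1,2)
      by (metis finite_subset_image)
    \<comment> \<open>The systems increase with the exponent, so the largest of finitely many contains \<open>\<Sigma>\<close>.
      The exponent \<open>0\<close> is inserted because \<open>K\<close> may be empty.\<close>
    then have "\<Sigma> \<subseteq> relators G n (y (Max (insert 0 K)))"
      using mono[OF Max_ge[of "insert 0 K"]] by blast
    then show thesis by (rule that)
  qed
  have stable: "relators G n (y (Suc m)) \<subseteq> relators G n (y m)"
    using \<Sigma>(3) y[of m] m by blast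
  have ker: "g = \<one>" if g: "g \<in> carrier G" "\<psi> g = \<one>" for g
  proof -
    obtain h where h: "h \<in> carrier G" "g = (\<psi> ^^ m) h" using pow_surj[of m] g(1) by blast
    obtain w where w: "w \<in> gwords n" "h = gword_val G s w"
      using gen h(1) by (auto simp: generating_tuple_def)
    have "w \<in> relators G n (y (Suc m))" using w g h by (simp add: relators_def val)
    then have "w \<in> relators G n (y m)" using stable by blast
    then show ?thesis using w h by (simp add: relators_def val)
  qed
  interpret h: group_hom G G \<psi>
    using hom by (simp add: group_hom_def group_hom_axioms_def is_group)
  have "inj_on \<psi> (carrier G)" using ker h.inj_on_one_iff by blast
  then show "\<psi> \<in> iso G G" using hom surj by (simp add: iso_def bij_betw_def)
qed

end


section \<open>Finitely presented groups\<close>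

lemma hom_free_group_eq_gword_val:
  assumes "group G" "f \<in> hom (free_group n) G" "w \<in> gwords n"
  shows "f (free_rel n `` {w}) = gword_val G (\<lambda>i. f (free_rel n `` {[(i, True)]})) w"
proof -
  interpret F: group "free_group n" by (rule group_free_group)
  let ?x = "\<lambda>i. free_rel n `` {[(i, True)]}"
  have x: "?x \<in> {..<n} \<rightarrow> carrier (free_group n)"
    by (auto intro!: carrier_free_groupI simp: gwords_def)
  have "gword_val (free_group n) ?x w = free_rel n `` {w}"
    using assms(3)
  proof (induction w)
    case Nil
    then show ?case by (simp add: one_free_group)
  next
    case (Cons l w)
    obtain i b where l: "l = (i, b)" by (cases l)
    have i: "i < n" "[(i, True)] \<in> gwords n" "[(i, False)] \<in> gwords n" "w \<in> gwords n"
      using Cons.prems l by (auto simp: gwords_def)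
    have "[(i, False)] = gword_inv [(i, True)]" by (simp add: gword_inv_def)
    then have "free_rel n `` {[(i, False)]} \<otimes>\<^bsub>free_group n\<^esub> ?x i = \<one>\<^bsub>free_group n\<^esub>"
      using i equiv_class_eq[OF equiv_free_rel free_rel_gword_inv[OF i(2)]]
      by (simp only: free_group_mult one_free_group)
    then have "inv\<^bsub>free_group n\<^esub> (?x i) = free_rel n `` {[(i, False)]}"
      using i by (intro F.inv_equality carrier_free_groupI)
    then show ?case using Cons.IH i l by (simp add: free_group_mult)
  qed
  then show ?thesis
    using F.hom_gword_val[OF assms(1,2) x assms(3)] by simp
qed

text \<open>Evaluation at \<open>y\<close> is a homomorphism on the free group, so its kernel is a normal subgroup;
  once it contains \<open>R\<close> it contains the normal closure.\<close>

lemma (in group) gword_val_normal_closure: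
  assumes y: "y \<in> {..<n} \<rightarrow> carrier G"
    and R: "R \<subseteq> carrier (free_group n)"
    and R_one: "\<And>w. w \<in> gwords n \<Longrightarrow> free_rel n `` {w} \<in> R \<Longrightarrow> gword_val G y w = \<one>"
    and w: "w \<in> gwords n" "free_rel n `` {w} \<in> normal_closure (free_group n) R"
  shows "gword_val G y w = \<one>"
proof -
  interpret F: group "free_group n" by (rule group_free_group)
  define ev where "ev A = gword_val G y (SOME w. w \<in> A)" for A
  have ev: "ev (free_rel n `` {u}) = gword_val G y u" if "u \<in> gwords n" for u
  proof -
    have "u \<in> free_rel n `` {u}" using that by (auto intro: free_rel.refl)
    then have "(SOME v. v \<in> free_rel n `` {u}) \<in> free_rel n `` {u}" by (rule someI)
    then have "(u, SOME v. v \<in> free_rel n `` {u}) \<in> free_rel n" by simp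
    then show ?thesis unfolding ev_def by (rule gword_val_free_rel[OF y, symmetric])
  qed
  have "ev \<in> hom (free_group n) G"
  proof (rule homI)
    fix A B assume A: "A \<in> carrier (free_group n)" and B: "B \<in> carrier (free_group n)"
    obtain u where u: "u \<in> gwords n" "A = free_rel n `` {u}" using A by (rule carrier_free_groupE)
    obtain v where v: "v \<in> gwords n" "B = free_rel n `` {v}" using B by (rule carrier_free_groupE)
    show "ev A \<in> carrier G" using u ev gword_val_closed[OF y] by simp
    show "ev (A \<otimes>\<^bsub>free_group n\<^esub> B) = ev A \<otimes> ev B"
      using u v by (simp add: free_group_mult ev gwords_append gword_val_append[OF y])
  qed
  then interpret ev: group_hom "free_group n" G ev
    by (simp add: group_hom_def group_hom_axioms_def is_group F.is_group)
  have "ev A = \<one>" if "A \<in> R" for A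
  proof -
    have "A \<in> carrier (free_group n)" using that R by blast
    then obtain u where "u \<in> gwords n" "A = free_rel n `` {u}" by (rule carrier_free_groupE)
    then show ?thesis using R_one that ev by simp
  qed
  then have "R \<subseteq> kernel (free_group n) G ev"
    using R by (auto simp: kernel_def)
  then have "normal_closure (free_group n) R \<subseteq> kernel (free_group n) G ev"
    using ev.normal_kernel unfolding normal_closure_def by blast
  then show ?thesis using w ev by (auto simp: kernel_def)
qed

text \<open>The tuple consists of the images of the free generators, whose relators are exactly the words
  in the normal closure of the defining relators. A defining relator is a class of words, of which any
  one serves as an equation.\<close>

lemma (in group) finite_relators_presented:
  assumes "finitely_presented G"
  obtains n s where "generating_tuple G n s" "finitely_related_tuple G n s"
proof -
  obtain n R where R: "finite R" "R \<subseteq> carrier (free_group n)"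
    and iso: "G \<cong> free_group n Mod normal_closure (free_group n) R"
    using assms by (auto simp: finitely_presented_def)
  interpret F: group "free_group n" by (rule group_free_group)
  let ?N = "normal_closure (free_group n) R"
  interpret N: normal ?N "free_group n" by (rule F.normal_closure_normal[OF R(2)])
  interpret Q: group "free_group n Mod ?N" by (rule N.factorgroup_is_group)
  obtain k where k: "k \<in> iso (free_group n Mod ?N) G"
    using iso_sym[OF iso] by (auto simp: is_iso_def)
  then have k_hom: "k \<in> hom (free_group n Mod ?N) G"
    and k_bij: "bij_betw k (carrier (free_group n Mod ?N)) (carrier G)"
    by (simp_all add: iso_def)
  define f where "f A = k (?N #>\<^bsub>free_group n\<^esub> A)" for A
  have f_hom: "f \<in> hom (free_group n) G"
    using Group.hom_compose[OF N.r_coset_hom_Mod k_hom] by (simp add: f_def[abs_def] comp_def)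
  have f_surj: "f ` carrier (free_group n) = carrier G"
    using k_bij by (auto simp: bij_betw_def FactGroup_def RCOSETS_def f_def image_def)
  have f_one: "f A = \<one> \<longleftrightarrow> A \<in> ?N" if A: "A \<in> carrier (free_group n)" for A
  proof -
    have "k (\<one>\<^bsub>free_group n Mod ?N\<^esub>) = \<one>"
      using hom_one[OF k_hom Q.is_group is_group] .
    moreover have "\<one>\<^bsub>free_group n Mod ?N\<^esub> = ?N" by (simp add: FactGroup_def)
    moreover have "?N #>\<^bsub>free_group n\<^esub> A \<in> carrier (free_group n Mod ?N)"
      using A by (auto simp: FactGroup_def RCOSETS_def)
    moreover have "inj_on k (carrier (free_group n Mod ?N))"
      using k_bij by (simp add: bij_betw_def)
    ultimately have "f A = \<one> \<longleftrightarrow> ?N #>\<^bsub>free_group n\<^esub> A = ?N"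
      unfolding f_def by (metis Q.one_closed inj_on_eq_iff)
    then show ?thesis
      using A F.coset_join1 F.coset_join2 N.is_subgroup N.subset by metis
  qed
  define s where "s i = f (free_rel n `` {[(i, True)]})" for i
  have val: "f (free_rel n `` {w}) = gword_val G s w" if "w \<in> gwords n" for w
    using hom_free_group_eq_gword_val[OF is_group f_hom that] by (simp add: s_def[abs_def])
  have s: "s \<in> {..<n} \<rightarrow> carrier G"
    by (auto simp: s_def gwords_def intro!: hom_in_carrier[OF f_hom] carrier_free_groupI)
  have "carrier G \<subseteq> gword_val G s ` gwords n"
  proof
    fix g assume "g \<in> carrier G"
    then obtain A where A: "A \<in> carrier (free_group n)" "g = f A" using f_surj by blast
    from A(1) obtain w where "w \<in> gwords n" "A = free_rel n `` {w}" by (rule carrier_free_groupE)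
    then show "g \<in> gword_val G s ` gwords n" using A(2) val by blast
  qed
  with s have gen: "generating_tuple G n s" by (simp add: generating_tuple_def)
  have "\<exists>w. w \<in> gwords n \<and> A = free_rel n `` {w}" if "A \<in> R" for A
    by (rule carrier_free_groupE[of A n]) (use that R(2) in auto)
  then obtain rep where rep: "\<And>A. A \<in> R \<Longrightarrow> rep A \<in> gwords n \<and> A = free_rel n `` {rep A}"
    by metis
  have "R \<subseteq> ?N" by (auto simp: normal_closure_def)
  have rel: "w \<in> relators G n s \<longleftrightarrow> w \<in> gwords n \<and> free_rel n `` {w} \<in> ?N" for w
    using f_one[OF carrier_free_groupI] val by (auto simp: relators_def)
  have "finitely_related_tuple G n s"
    unfolding finitely_related_tuple_def
  proof (intro exI[of _ "rep ` R"] conjI ballI impI)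
    show "finite (rep ` R)" using R(1) by simp
    show "rep ` R \<subseteq> relators G n s" using rep \<open>R \<subseteq> ?N\<close> rel by force
    fix y assume y: "y \<in> {..<n} \<rightarrow> carrier G" and sub: "rep ` R \<subseteq> relators G n y"
    have R_one: "gword_val G y w = \<one>" if "w \<in> gwords n" "free_rel n `` {w} \<in> R" for w
    proof -
      let ?r = "rep (free_rel n `` {w})"
      have "free_rel n `` {w} = free_rel n `` {?r}" using rep that(2) by blast
      then have "(w, ?r) \<in> free_rel n"
        using eq_equiv_class_iff[OF equiv_free_rel that(1)] rep that(2) by blast
      then have "gword_val G y w = gword_val G y ?r" by (rule gword_val_free_rel[OF y])
      then show ?thesis using sub that(2) by (auto simp: relators_def)
    qed
    show "relators G n s \<subseteq> relators G n y"
      using gword_val_normal_closure[OF y R(2) R_one] rel by (auto simp: relators_def)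
  qed
  with gen show thesis by (rule that)
qed


section \<open>Existential closure of finite systems\<close>

definition shift_word :: "nat \<Rightarrow> gword \<Rightarrow> gword" where
  "shift_word n w = map (\<lambda>(i, b). (n + i, b)) w"

lemma gword_val_shift_word: "gword_val G a (shift_word n w) = gword_val G (\<lambda>i. a (n + i)) w"
  by (induction w) (auto simp: shift_word_def)

lemma gword_vars_shift_word: "w \<in> gwords m \<Longrightarrow> gword_vars (shift_word n w) \<subseteq> {n..<n + m}"
  by (auto simp: gword_vars_def shift_word_def gwords_def)

definition conj_eqns :: "gword list \<Rightarrow> ep_formula" where
  "conj_eqns ws = foldr (\<lambda>w. Conj (Eqn w)) ws (Eqn [])"

lemma satisfies_conj_eqns: "satisfies G a (conj_eqns ws) \<longleftrightarrow> (\<forall>w\<in>set ws. gword_val G a w = \<one>\<^bsub>G\<^esub>)"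
  by (induction ws) (auto simp: conj_eqns_def)

lemma free_vars_conj_eqns: "free_vars (conj_eqns ws) = (\<Union>w\<in>set ws. gword_vars w)"
  by (induction ws) (auto simp: conj_eqns_def gword_vars_def)

primrec exists_block :: "nat \<Rightarrow> nat \<Rightarrow> ep_formula \<Rightarrow> ep_formula" where
  "exists_block n 0 \<theta> = \<theta>"
| "exists_block n (Suc m) \<theta> = exists_block n m (Exists (n + m) \<theta>)"

lemma free_vars_exists_block: "free_vars (exists_block n m \<theta>) = free_vars \<theta> - {n..<n + m}"
  by (induction m arbitrary: \<theta>) auto

lemma satisfies_exists_block:
  "satisfies G a (exists_block n m \<theta>) \<longleftrightarrow>
     (\<exists>y \<in> {..<m} \<rightarrow> carrier G. satisfies G (\<lambda>i. if i \<in> {n..<n + m} then y (i - n) else a i) \<theta>)"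
proof (induction m arbitrary: \<theta>)
  case 0
  then show ?case by auto
next
  case (Suc m)
  let ?a = "\<lambda>m y i. if i \<in> {n..<n + m} then y (i - n) else a i"
  have upd: "(?a m y)(n + m := g) = ?a (Suc m) (y(m := g))" for y g
    by (auto simp: fun_eq_iff)
  have "satisfies G a (exists_block n (Suc m) \<theta>) \<longleftrightarrow>
      (\<exists>y \<in> {..<m} \<rightarrow> carrier G. \<exists>g \<in> carrier G. satisfies G (?a (Suc m) (y(m := g))) \<theta>)"
    unfolding upd[symmetric] by (simp add: Suc.IH)
  also have "\<dots> \<longleftrightarrow> (\<exists>y \<in> {..<Suc m} \<rightarrow> carrier G. satisfies G (?a (Suc m) y) \<theta>)"
  proof (intro iffI; elim bexE)
    fix y g assume "y \<in> {..<m} \<rightarrow> carrier G" "g \<in> carrier G" "satisfies G (?a (Suc m) (y(m := g))) \<theta>"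
    then show "\<exists>y \<in> {..<Suc m} \<rightarrow> carrier G. satisfies G (?a (Suc m) y) \<theta>"
      by (intro bexI[of _ "y(m := g)"]) (auto simp: less_Suc_eq)
  next
    fix y assume y: "y \<in> {..<Suc m} \<rightarrow> carrier G" "satisfies G (?a (Suc m) y) \<theta>"
    show "\<exists>y \<in> {..<m} \<rightarrow> carrier G. \<exists>g \<in> carrier G. satisfies G (?a (Suc m) (y(m := g))) \<theta>"
    proof (rule bexI[of _ y], rule bexI[of _ "y m"])
      show "satisfies G (?a (Suc m) (y(m := y m))) \<theta>"
        using y(2) by (simp only: fun_upd_triv)
    qed (use y(1) in auto)
  qed
  finally show ?case .
qed

text \<open>Solvability in \<open>y\<close> of the system \<open>\<Sigma>(y) = 1\<close>, \<open>x i = w i (y)\<close> is an existential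
  positive property of \<open>x\<close> because \<open>\<Sigma>\<close> is finite. The formula keeps \<open>x\<close> in the variables
  below \<open>n\<close> and moves \<open>y\<close> to the next \<open>n\<close> variables.\<close>

lemma (in group) exists_formula_of_system:
  assumes "finite \<Sigma>" "\<Sigma> \<subseteq> gwords n" "\<And>i. i < n \<Longrightarrow> w i \<in> gwords n"
  obtains \<theta> where "free_vars \<theta> \<subseteq> {..<n}"
    "\<forall>x \<in> {..<n} \<rightarrow> carrier G. satisfies G x \<theta> \<longleftrightarrow>
       (\<exists>y \<in> {..<n} \<rightarrow> carrier G. \<Sigma> \<subseteq> relators G n y \<and> (\<forall>i<n. x i = gword_val G y (w i)))"
proof -
  obtain ws where ws: "set ws = \<Sigma>" using finite_list[OF assms(1)] by blast
  \<comment> \<open>The second list consists of the words \<open>(x i)\<^sup>-\<^sup>1 w i (y)\<close>.\<close>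
  define \<theta> where "\<theta> = conj_eqns
    (map (shift_word n) ws @ map (\<lambda>i. (i, False) # shift_word n (w i)) [0..<n])"
  have fv: "free_vars \<theta> \<subseteq> {..<n + n}"
  proof -
    have "gword_vars (shift_word n u) \<subseteq> {..<n + n}" if "u \<in> gwords n" for u
      using gword_vars_shift_word[OF that] by fastforce
    moreover have "gword_vars ((i, False) # u) = insert i (gword_vars u)" for i u
      by (simp add: gword_vars_def)
    ultimately show ?thesis
      using assms(2,3) ws unfolding \<theta>_def free_vars_conj_eqns by fastforce
  qed
  show thesis
  proof (rule that[OF _ ballI])
    show "free_vars (exists_block n n \<theta>) \<subseteq> {..<n}"
      using fv by (fastforce simp: free_vars_exists_block)
    fix x assume x: "x \<in> {..<n} \<rightarrow> carrier G"
    have "satisfies G (\<lambda>i. if i \<in> {n..<n + n} then y (i - n) else x i) \<theta> \<longleftrightarrow>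
        \<Sigma> \<subseteq> relators G n y \<and> (\<forall>i<n. x i = gword_val G y (w i))"
      if y: "y \<in> {..<n} \<rightarrow> carrier G" for y
    proof -
      let ?a = "\<lambda>i. if i \<in> {n..<n + n} then y (i - n) else x i"
      have val: "gword_val G ?a (shift_word n u) = gword_val G y u" if "u \<in> gwords n" for u
        unfolding gword_val_shift_word by (rule gword_val_cong[OF _ that]) simp
      have rel: "gword_val G ?a (shift_word n u) = \<one> \<longleftrightarrow> u \<in> relators G n y" if "u \<in> \<Sigma>" for u
        using val[OF subsetD[OF assms(2) that]] that assms(2) by (auto simp: relators_def)
      have eqn: "gword_val G ?a ((i, False) # shift_word n (w i)) = \<one> \<longleftrightarrow> x i = gword_val G y (w i)"
        if "i < n" for i
      proof -
        have c: "x i \<in> carrier G" "gword_val G y (w i) \<in> carrier G"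
          using that x gword_val_closed[OF y] assms(3) by auto
        have "gword_val G ?a ((i, False) # shift_word n (w i)) = inv (x i) \<otimes> gword_val G y (w i)"
          using that val assms(3) by simp
        then show ?thesis using c by (metis inv_closed inv_equality inv_inv l_inv)
      qed
      have "satisfies G ?a \<theta> \<longleftrightarrow> (\<forall>u\<in>\<Sigma>. gword_val G ?a (shift_word n u) = \<one>) \<and>
          (\<forall>i<n. gword_val G ?a ((i, False) # shift_word n (w i)) = \<one>)"
        unfolding \<theta>_def satisfies_conj_eqns set_append set_map ball_Un ball_simps ws by auto
      also have "(\<forall>u\<in>\<Sigma>. gword_val G ?a (shift_word n u) = \<one>) \<longleftrightarrow> \<Sigma> \<subseteq> relators G n y"
        using rel by blast
      also have "(\<forall>i<n. gword_val G ?a ((i, False) # shift_word n (w i)) = \<one>) \<longleftrightarrow>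
          (\<forall>i<n. x i = gword_val G y (w i))"
        using eqn by blast
      finally show ?thesis .
    qed
    then show "satisfies G x (exists_block n n \<theta>) \<longleftrightarrow>
       (\<exists>y \<in> {..<n} \<rightarrow> carrier G. \<Sigma> \<subseteq> relators G n y \<and> (\<forall>i<n. x i = gword_val G y (w i)))"
      unfolding satisfies_exists_block by blast
  qed
qed


section \<open>Elementary endomorphisms are automorphisms\<close>

lemma (in group) ep_elementary_left_inverse:
  assumes gen: "generating_tuple G n s" and fin: "finitely_related_tuple G n s"
    and elem: "ep_elementary_endo G \<phi>"
  obtains \<psi> where "\<psi> \<in> hom G G" "\<And>g. g \<in> carrier G \<Longrightarrow> \<psi> (\<phi> g) = g"
proof -
  have \<phi>: "\<phi> \<in> hom G G" using elem by (simp add: ep_elementary_endo_def)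
  have s: "s \<in> {..<n} \<rightarrow> carrier G" using gen by (simp add: generating_tuple_def)
  have \<phi>s: "(\<lambda>i. \<phi> (s i)) \<in> {..<n} \<rightarrow> carrier G" using s \<phi> by (auto simp: hom_def)
  have "\<exists>w. w \<in> gwords n \<and> \<phi> (s i) = gword_val G s w" if "i < n" for i
  proof -
    have "\<phi> (s i) \<in> carrier G" using \<phi>s that by auto
    then show ?thesis using gen by (auto simp: generating_tuple_def)
  qed
  then obtain w where w: "\<And>i. i < n \<Longrightarrow> w i \<in> gwords n"
      "\<And>i. i < n \<Longrightarrow> \<phi> (s i) = gword_val G s (w i)"
    by metis
  obtain \<Sigma> where \<Sigma>: "finite \<Sigma>" "\<Sigma> \<subseteq> relators G n s"
    "\<forall>y \<in> {..<n} \<rightarrow> carrier G. \<Sigma> \<subseteq> relators G n y \<longrightarrow> relators G n s \<subseteq> relators G n y"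
    using fin unfolding finitely_related_tuple_def by (elim exE conjE)
  have "\<Sigma> \<subseteq> gwords n" using \<Sigma>(2) by (auto simp: relators_def)
  then obtain \<theta> where fv: "free_vars \<theta> \<subseteq> {..<n}"
    and \<theta>: "\<forall>x \<in> {..<n} \<rightarrow> carrier G. satisfies G x \<theta> \<longleftrightarrow>
       (\<exists>y \<in> {..<n} \<rightarrow> carrier G. \<Sigma> \<subseteq> relators G n y \<and> (\<forall>i<n. x i = gword_val G y (w i)))"
    by (rule exists_formula_of_system[OF \<Sigma>(1) _ w(1)])
  have "satisfies G (\<lambda>i. \<phi> (s i)) \<theta>"
    unfolding \<theta>[rule_format, OF \<phi>s] using s \<Sigma>(2) w(2) by blast
  then have "satisfies G s \<theta>"
    using elem fv s unfolding ep_elementary_endo_def by blast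
  then obtain y where y: "y \<in> {..<n} \<rightarrow> carrier G" "\<Sigma> \<subseteq> relators G n y"
      "\<And>i. i < n \<Longrightarrow> s i = gword_val G y (w i)"
    unfolding \<theta>[rule_format, OF s] by blast
  obtain \<psi> where \<psi>: "\<psi> \<in> hom G G" "\<And>i. i < n \<Longrightarrow> \<psi> (s i) = y i"
    using endomorphism_extending[OF gen y(1) \<Sigma>(3)[rule_format, OF y(1,2)]] by blast
  have "\<psi> (\<phi> (s i)) = s i" if "i < n" for i
  proof -
    have "\<psi> (\<phi> (s i)) = gword_val G (\<lambda>i. \<psi> (s i)) (w i)"
      using hom_gword_val[OF is_group \<psi>(1) s w(1)[OF that]] w(2)[OF that] by simp
    also have "\<dots> = gword_val G y (w i)"
      by (rule gword_val_cong[OF \<psi>(2) w(1)[OF that]])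
    finally show ?thesis using y(3)[OF that] by simp
  qed
  moreover have "(\<lambda>g. \<psi> (\<phi> g)) \<in> hom G G" "(\<lambda>g. g) \<in> hom G G"
    using \<phi> \<psi>(1) by (auto simp: hom_def Pi_iff)
  ultimately have "\<psi> (\<phi> g) = g" if "g \<in> carrier G" for g
    using hom_eq_on_generating_tuple[OF gen, of "\<lambda>g. \<psi> (\<phi> g)" "\<lambda>g. g"] that by blast
  with \<psi>(1) show thesis by (rule that)
qed

text \<open>A left inverse \<open>\<psi>\<close> of \<open>\<phi>\<close> is surjective, hence injective; cancelling \<open>\<psi>\<close> in
  \<open>\<psi> (\<phi> (\<psi> g)) = \<psi> g\<close> then shows that \<open>\<phi>\<close> is onto.\<close>

lemma hopfian_left_invertible_iso:
  assumes "hopfian G" "\<phi> \<in> hom G G" "\<psi> \<in> hom G G"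
    and inv: "\<And>g. g \<in> carrier G \<Longrightarrow> \<psi> (\<phi> g) = g"
  shows "\<phi> \<in> iso G G"
proof -
  have closed: "\<phi> g \<in> carrier G" "\<psi> g \<in> carrier G" if "g \<in> carrier G" for g
    using that assms(2,3) by (auto simp: hom_def)
  have "\<psi> ` carrier G = carrier G"
  proof
    show "carrier G \<subseteq> \<psi> ` carrier G" using inv closed by (metis image_eqI subsetI)
  qed (use closed in auto)
  then have "\<psi> \<in> iso G G" using assms(1,3) by (simp add: hopfian_def epi_def)
  then have inj: "inj_on \<psi> (carrier G)" by (simp add: iso_def bij_betw_def)
  have "\<phi> (\<psi> g) = g" if "g \<in> carrier G" for g
    using inj_onD[OF inj] inv closed that by metis
  then have "bij_betw \<phi> (carrier G) (carrier G)"
    using inv closed by (intro bij_betw_byWitness[where f' = \<psi>]) auto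
  then show ?thesis using assms(2) by (simp add: iso_def)
qed

theorem theorem1p11:
  fixes G :: "('a, 'b) monoid_scheme" and \<phi> :: "'a \<Rightarrow> 'a"
  assumes "group G"
    and "finitely_generated G"
    and "equationally_noetherian G \<or> (finitely_presented G \<and> hopfian G)"
    and "ep_elementary_endo G \<phi>"
  shows "\<phi> \<in> iso G G"
proof -
  interpret group G by fact
  have "hopfian G" using assms(2,3) noetherian_hopfian by blast
  moreover obtain n s where "generating_tuple G n s" "finitely_related_tuple G n s"
    using assms(3)
  proof
    assume "equationally_noetherian G"
    with that show thesis
      using generating_tuple_exists[OF assms(2)] finite_relators_noetherian by metis
  next
    assume "finitely_presented G \<and> hopfian G"
    with that show thesis using finite_relators_presented by blast
  qed
  then obtain \<psi> where "\<psi> \<in> hom G G" "\<And>g. g \<in> carrier G \<Longrightarrow> \<psi> (\<phi> g) = g"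
    using ep_elementary_left_inverse assms(4) by blast
  moreover have "\<phi> \<in> hom G G" using assms(4) by (simp add: ep_elementary_endo_def)
  ultimately show ?thesis using hopfian_left_invertible_iso by blast
qed

end
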